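(* Let $C$ be a nonempty weakly compact convex subset of a Banach space $X$ and let $T:C\to C$ be a pointwise eventually nonexpansive mapping. Suppose that for each sequence $\{x_n\}$ in $C$ the asymptotic center $A(C,\{x_n\})$ of $\{x_n\}$ relative to $C$ is compact (in the norm topology). Then $T$ has a fixed point, i.e. there exists $x\in C$ with $Tx=x$.
   Context: Let $C$ be a nonempty subset of a Banach space $(X,\Vert\cdot\Vert)$. A mapping $T:C\to C$ (no continuity is assumed) is pointwise eventually nonexpansive if for every $x\in C$ there exists $N(x)\in\mathbb{N}$ such that for all $n\ge N(x)$ one has $\Vert T^nx-T^ny\Vert\le\Vert x-y\Vert$ for all $y\in C$, where $T^n$ is the $n$-th iterate of $T$. For a bounded sequence $\{x_n\}$ in $X$, the asymptotic radius of $\{x_n\}$ with respect to $C$ is $r(C,\{x_n\})=\inf\{\limsup_n\Vert x_n-x\Vert : x\in C\}$, and the asymptotic center of $\{x_n\}$ with respect to $C$ is the set $A(C,\{x_n\})=\{x\in C:\limsup_n\Vert x_n-x\Vert=r(C,\{x_n\})\}$. *)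

theory Defs
  imports "HOL-Analysis.Analysis"
begin

text \<open>The coarsest topology on a real normed space making all bounded linear functionals
  continuous.\<close>

definition weak_topology :: "'a::real_normed_vector topology" where
  "weak_topology =
     topology_generated_by {blinfun_apply f -` U | (f :: 'a \<Rightarrow>\<^sub>L real) U. open U}"

lemma topspace_weak_topology [simp]: "topspace weak_topology = UNIV"
  unfolding weak_topology_def topology_generated_by_topspace
  using open_UNIV by blast

definition pointwise_eventually_nonexpansive_on ::
    "'a::real_normed_vector set \<Rightarrow> ('a \<Rightarrow> 'a) \<Rightarrow> bool" where
  "pointwise_eventually_nonexpansive_on C T \<longleftrightarrow>
     T \<in> C \<rightarrow> C \<and>
     (\<forall>x\<in>C. \<exists>N. \<forall>n\<ge>N. \<forall>y\<in>C. norm ((T ^^ n) x - (T ^^ n) y) \<le> norm (x - y))"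

text \<open>Limits superior and infima are taken in the extended reals, where they always exist.
  They are finite when the sequence is bounded and \<open>C\<close> is nonempty.\<close>

definition asymptotic_radius ::
    "'a::real_normed_vector set \<Rightarrow> (nat \<Rightarrow> 'a) \<Rightarrow> ereal" where
  "asymptotic_radius C x = (INF z\<in>C. limsup (\<lambda>n. ereal (norm (x n - z))))"

definition asymptotic_center ::
    "'a::real_normed_vector set \<Rightarrow> (nat \<Rightarrow> 'a) \<Rightarrow> 'a set" where
  "asymptotic_center C x =
     {z \<in> C. limsup (\<lambda>n. ereal (norm (x n - z))) = asymptotic_radius C x}"

end

theory Submission
  imports Defs
begin

text \<open>
  Fix \<open>x \<in> C\<close> and let \<open>A\<close> be the asymptotic center in \<open>C\<close> of its orbit. By Mazur's theorem the
  sublevel sets of \<open>z \<mapsto> limsup \<parallel>T\<^sup>n x - z\<parallel>\<close>, being closed and convex, are weakly closed, so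
  weak compactness of \<open>C\<close> makes \<open>A\<close> nonempty (\<open>asymptotic_center_nonempty\<close>). It is convex, and
  compact by assumption. For \<open>z \<in> C\<close> and all large \<open>n\<close>, the distance from \<open>T\<^sup>m\<^sup>+\<^sup>n x\<close> to \<open>T\<^sup>n z\<close>
  is at most the distance from \<open>T\<^sup>m x\<close> to \<open>z\<close>; hence \<open>T\<^sup>n z\<close> stays in every sublevel set that
  contains \<open>z\<close> (\<open>eventually_sublevel_invariant\<close>), and the orbit of each point of \<open>A\<close> is
  eventually in \<open>A\<close>.

  How late the orbit enters \<open>A\<close> depends on the point, so this kind of invariance does not pass to
  intersections of chains. Invariance under cluster points of orbits does. Zorn's lemma thus yields
  a minimal nonempty closed convex \<open>K \<subseteq> A\<close> that contains all cluster points of the orbits of its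
  points. Let \<open>W \<subseteq> K\<close> be the set of cluster points of the orbit of some \<open>x \<in> K\<close>. The points of \<open>K\<close>
  within distance \<open>s\<close> of all of \<open>W\<close> are those in a sublevel set of the orbit, so they form a set
  of the same kind as \<open>K\<close>; by minimality they are all of \<open>K\<close> as soon as there is one. A compact
  set has a point in its convex hull that is nondiametral (\<open>compact_nondiametral_point\<close>), so if
  \<open>W\<close> had positive diameter, all of \<open>W\<close> would lie within some \<open>s < diameter W\<close> of each of its
  points, which is absurd. Hence \<open>W\<close> is a single point \<open>z\<close>, and taking \<open>s = 0\<close> gives \<open>K = {z}\<close>.

  The orbit of \<open>z\<close> then has \<open>z\<close> as its only cluster point, so \<open>T\<^sup>m z\<close> converges to \<open>z\<close>. For large
  \<open>n\<close> the iterate \<open>T\<^sup>n\<close> is continuous at \<open>z\<close> along this orbit, so \<open>T\<^sup>n z = lim T\<^sup>m\<^sup>+\<^sup>n z = z\<close>. Using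
  this for two consecutive \<open>n\<close> gives \<open>T z = z\<close>.
\<close>

section \<open>Minimal sublinear functionals and separation\<close>

definition sublinear :: "('a::real_vector \<Rightarrow> real) \<Rightarrow> bool" where
  "sublinear p \<longleftrightarrow>
     (\<forall>x y. p (x + y) \<le> p x + p y) \<and> (\<forall>t\<ge>0. \<forall>x. p (t *\<^sub>R x) = t * p x)"

lemma sublinear_add: "sublinear p \<Longrightarrow> p (x + y) \<le> p x + p y"
  by (simp add: sublinear_def)

lemma sublinear_scale: "sublinear p \<Longrightarrow> 0 \<le> t \<Longrightarrow> p (t *\<^sub>R x) = t * p x"
  by (simp add: sublinear_def)

lemma sublinear_zero: "sublinear p \<Longrightarrow> p 0 = 0"
  using sublinear_scale[of p 0 0] by simp

lemma sublinear_lower: "sublinear p \<Longrightarrow> - p (- x) \<le> p x"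
  using sublinear_add[of p x "- x"] sublinear_zero[of p] by simp

lemma sublinear_norm: "sublinear norm"
  by (simp add: sublinear_def norm_triangle_ineq)

text \<open>The common part of the two infima formed below, over a cone and over a chain: sublinearity
  passes to a pointwise infimum when the family is directed in the sense of \<open>add\<close>. The
  minorant \<open>l\<close> keeps the infimum real-valued.\<close>
lemma sublinear_INF:
  fixes g :: "'i \<Rightarrow> 'a::real_vector \<Rightarrow> real"
  assumes lower: "\<And>i x. i \<in> I \<Longrightarrow> l x \<le> g i x" and "l 0 = 0"
    and zero: "\<exists>i\<in>I. g i 0 \<le> 0"
    and add: "\<And>i j x y. i \<in> I \<Longrightarrow> j \<in> I \<Longrightarrow> \<exists>k\<in>I. g k (x + y) \<le> g i x + g j y"
    and scale: "\<And>i t x. i \<in> I \<Longrightarrow> 0 < t \<Longrightarrow> \<exists>k\<in>I. g k (t *\<^sub>R x) \<le> t * g i x"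
  shows "sublinear (\<lambda>x. INF i\<in>I. g i x)"
proof -
  let ?q = "\<lambda>x. INF i\<in>I. g i x"
  have ne: "I \<noteq> {}" using zero by auto
  have bdd: "bdd_below ((\<lambda>i. g i x) ` I)" for x
    using lower by (auto intro!: bdd_belowI2)
  have le: "?q x \<le> g i x" if "i \<in> I" for i x
    using bdd that by (rule cINF_lower)
  have "?q (x + y) \<le> ?q x + ?q y" for x y
  proof -
    have sum: "?q (x + y) \<le> g i x + g j y" if "i \<in> I" "j \<in> I" for i j
      using add[OF that] le order_trans by meson
    have "?q (x + y) - g i x \<le> ?q y" if "i \<in> I" for i
      using sum[OF that] by (intro cINF_greatest ne) (simp add: algebra_simps)
    then have "?q (x + y) - ?q y \<le> ?q x"
      by (intro cINF_greatest ne) (simp add: algebra_simps)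
    then show ?thesis by simp
  qed
  moreover have scale_le: "?q (t *\<^sub>R x) \<le> t * ?q x" if "0 < t" for t x
  proof -
    have "?q (t *\<^sub>R x) \<le> t * g i x" if "i \<in> I" for i
      using scale[OF that \<open>0 < t\<close>] le order_trans by meson
    then have "?q (t *\<^sub>R x) / t \<le> ?q x"
      using \<open>0 < t\<close> by (intro cINF_greatest ne) (simp add: field_simps)
    then show ?thesis using \<open>0 < t\<close> by (simp add: field_simps)
  qed
  \<comment> \<open>The opposite inequality is the same one for \<open>1 / t\<close>.\<close>
  moreover have "?q (t *\<^sub>R x) \<ge> t * ?q x" if "0 < t" for t x
    using scale_le[of "1 / t" "t *\<^sub>R x"] that by (simp add: field_simps)
  moreover have "?q 0 = 0"
  proof (rule antisym)
    show "?q 0 \<le> 0" using zero le order_trans by meson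
    show "0 \<le> ?q 0" using lower[of _ 0] \<open>l 0 = 0\<close> by (intro cINF_greatest ne) simp
  qed
  ultimately show ?thesis
    by (auto simp: sublinear_def le_less intro: antisym)
qed

text \<open>The functional \<open>x \<mapsto> inf {q (x + t u) - t d | t \<ge> 0, u \<in> D}\<close> does it. With \<open>D = {y}\<close> and
  \<open>d = q y\<close> it shows that a minimal sublinear functional is odd; with \<open>q\<close> the norm and \<open>D\<close> a
  convex set at distance at least \<open>d\<close> from the origin it is the functional whose linear minorants separate.\<close>
lemma sublinear_decrease_on_convex:
  assumes q: "sublinear q" and "convex D" "D \<noteq> {}" and D: "\<And>u. u \<in> D \<Longrightarrow> d \<le> q u"
  obtains q' where "sublinear q'" "\<And>x. q' x \<le> q x" "\<And>u. u \<in> D \<Longrightarrow> q' (- u) \<le> - d"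
proof -
  let ?I = "{0::real..} \<times> D"
  define g where "g = (\<lambda>(t, u) x. q (x + t *\<^sub>R u) - t * d)"
  let ?q = "\<lambda>x. INF i\<in>?I. g i x"
  have lower: "- q (- x) \<le> g i x" if i: "i \<in> ?I" for i x
  proof -
    obtain t u where [simp]: "i = (t, u)" and tu: "0 \<le> t" "u \<in> D" using i by auto
    have "t * d \<le> t * q u" using tu D by (simp add: mult_left_mono)
    also have "\<dots> = q ((x + t *\<^sub>R u) + - x)" using q tu by (simp add: sublinear_scale)
    also have "\<dots> \<le> q (x + t *\<^sub>R u) + q (- x)" by (rule sublinear_add[OF q])
    finally show ?thesis by (simp add: g_def)
  qed
  have below: "?q x \<le> g i x" if "i \<in> ?I" for i x
    using that lower by (intro cINF_lower bdd_belowI2)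
  obtain u0 where u0: "u0 \<in> D" using \<open>D \<noteq> {}\<close> by auto
  show thesis
  proof (rule that)
    show "sublinear ?q"
    proof (rule sublinear_INF[where l = "\<lambda>x. - q (- x)"])
      show "\<exists>i\<in>?I. g i 0 \<le> 0"
        using u0 sublinear_zero[OF q] by (intro bexI[of _ "(0, u0)"]) (auto simp: g_def)
    next
      fix i j x y assume ij: "i \<in> ?I" "j \<in> ?I"
      obtain t u where [simp]: "i = (t, u)" and tu: "0 \<le> t" "u \<in> D" using ij by auto
      obtain s v where [simp]: "j = (s, v)" and sv: "0 \<le> s" "v \<in> D" using ij by auto
      \<comment> \<open>By convexity the cone spanned by \<open>D\<close> is closed under addition.\<close>
      obtain w where w: "w \<in> D" "(t + s) *\<^sub>R w = t *\<^sub>R u + s *\<^sub>R v"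
      proof (cases "t + s = 0")
        case True
        then show ?thesis using tu sv that[of u] by (simp add: add_nonneg_eq_0_iff)
      next
        case False
        have "(t / (t + s)) *\<^sub>R u + (s / (t + s)) *\<^sub>R v \<in> D"
          using False tu sv \<open>convex D\<close>
          by (intro convexD) (auto simp: add_divide_distrib[symmetric])
        then show ?thesis using False that by (force simp: scaleR_add_right)
      qed
      have "g (t + s, w) (x + y) = q ((x + t *\<^sub>R u) + (y + s *\<^sub>R v)) - (t + s) * d"
        by (simp add: g_def w(2) add.assoc add.left_commute)
      also have "\<dots> \<le> g i x + g j y"
        using sublinear_add[OF q, of "x + t *\<^sub>R u" "y + s *\<^sub>R v"]
        by (simp add: g_def algebra_simps)
      finally show "\<exists>k\<in>?I. g k (x + y) \<le> g i x + g j y"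
        using tu sv w(1) by (intro bexI[of _ "(t + s, w)"]) auto
    next
      fix i and t :: real and x assume i: "i \<in> ?I" and t: "0 < t"
      obtain s u where [simp]: "i = (s, u)" and su: "0 \<le> s" "u \<in> D" using i by auto
      have "g (t * s, u) (t *\<^sub>R x) = q (t *\<^sub>R (x + s *\<^sub>R u)) - t * s * d"
        by (simp add: g_def scaleR_add_right)
      also have "\<dots> = t * g i x"
        using sublinear_scale[OF q, of t "x + s *\<^sub>R u"] t by (simp add: g_def algebra_simps)
      finally show "\<exists>k\<in>?I. g k (t *\<^sub>R x) \<le> t * g i x"
        using t su by (intro bexI[of _ "(t * s, u)"]) auto
    qed (use lower sublinear_zero[OF q] in auto)
    show "?q x \<le> q x" for x
      using below[of "(0, u0)" x] u0 by (simp add: g_def)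
    show "?q (- u) \<le> - d" if "u \<in> D" for u
      using below[of "(1, u)" "- u"] that sublinear_zero[OF q] by (simp add: g_def)
  qed
qed

text \<open>Hahn--Banach, without partially defined functionals: by Zorn's lemma there is a minimal
  sublinear functional below \<open>p\<close>. It cannot be decreased at any \<open>- y\<close>, so it is odd, and an odd
  sublinear functional is linear.\<close>
lemma linear_below_sublinear:
  fixes p :: "'a::real_vector \<Rightarrow> real"
  assumes p: "sublinear p"
  obtains f where "linear f" "\<And>x. f x \<le> p x"
proof -
  define Q where "Q = {q. sublinear q \<and> (\<forall>x. q x \<le> p x)}"
  let ?R = "relation_of (\<lambda>a b. b \<le> (a :: 'a \<Rightarrow> real)) Q"
  have "\<exists>q\<in>Q. \<forall>a\<in>Q. a \<le> q \<longrightarrow> a = q"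
  proof (rule predicate_Zorn)
    show "partial_order_on Q ?R"
      by (auto simp: partial_order_on_def preorder_on_def refl_on_def trans_def antisym_def
          relation_of_def intro: order_trans antisym)
  next
    fix S assume "S \<in> Chains ?R"
    then have SQ: "S \<subseteq> Q" and chain: "\<And>a b. a \<in> S \<Longrightarrow> b \<in> S \<Longrightarrow> a \<le> b \<or> b \<le> a"
      by (auto simp: Chains_def relation_of_def)
    show "\<exists>u\<in>Q. \<forall>a\<in>S. u \<le> a"
    proof (cases "S = {}")
      case True
      then show ?thesis using p by (auto simp: Q_def)
    next
      case False
      let ?q = "\<lambda>x. INF q\<in>S. q x"
      have lower: "- p (- x) \<le> q x" if "q \<in> S" for q x
      proof -
        have "sublinear q" "q (- x) \<le> p (- x)" using that SQ by (auto simp: Q_def)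
        then show ?thesis using sublinear_lower[of q x] by simp
      qed
      have below: "?q x \<le> q x" if "q \<in> S" for q x
        using that lower by (intro cINF_lower bdd_belowI2)
      have "sublinear ?q"
      proof (rule sublinear_INF[where l = "\<lambda>x. - p (- x)"])
        show "\<exists>q\<in>S. q 0 \<le> 0"
        proof -
          obtain q where "q \<in> S" using False by blast
          then show ?thesis using SQ sublinear_zero[of q] by (intro bexI[of _ q]) (auto simp: Q_def)
        qed
      next
        fix q r x y assume qr: "q \<in> S" "r \<in> S"
        then have sub: "sublinear q" "sublinear r" using SQ by (auto simp: Q_def)
        show "\<exists>k\<in>S. k (x + y) \<le> q x + r y"
        proof (cases "q \<le> r")
          case True
          then have "q y \<le> r y" by (simp add: le_fun_def)
          then have "q (x + y) \<le> q x + r y" using sublinear_add[OF sub(1), of x y] by simp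
          then show ?thesis using qr by blast
        next
          case False
          then have "r x \<le> q x" using chain[OF qr] by (auto simp: le_fun_def)
          then have "r (x + y) \<le> q x + r y" using sublinear_add[OF sub(2), of x y] by simp
          then show ?thesis using qr by blast
        qed
      next
        fix q and t :: real and x assume "q \<in> S" "0 < t"
        then show "\<exists>k\<in>S. k (t *\<^sub>R x) \<le> t * q x"
          using SQ sublinear_scale[of q t x] by (intro bexI[of _ q]) (auto simp: Q_def)
      qed (use lower sublinear_zero[OF p] in auto)
      moreover have "?q x \<le> p x" for x
      proof -
        obtain q where "q \<in> S" using False by blast
        moreover then have "q x \<le> p x" using SQ by (auto simp: Q_def)
        ultimately show ?thesis using below[of q x] by simp
      qed
      ultimately show ?thesis
        using below by (intro bexI[of _ ?q]) (auto simp: Q_def le_fun_def)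
    qed
  qed
  then obtain q where qQ: "q \<in> Q" and min: "\<And>a. a \<in> Q \<Longrightarrow> a \<le> q \<Longrightarrow> a = q" by blast
  have q: "sublinear q" and qp: "\<And>x. q x \<le> p x" using qQ by (auto simp: Q_def)
  \<comment> \<open>Otherwise \<open>q\<close> could be lowered at \<open>- y\<close> to \<open>- q y\<close>.\<close>
  have odd: "q (- y) = - q y" for y
  proof -
    obtain q' where q': "sublinear q'" "\<And>x. q' x \<le> q x" "q' (- y) \<le> - q y"
      using sublinear_decrease_on_convex[OF q, of "{y}" "q y"] by auto
    have "q' = q"
      using q' qp by (intro min) (auto simp: Q_def le_fun_def intro: order_trans)
    then show ?thesis using q'(3) sublinear_lower[OF q, of y] by simp
  qed
  have "q (x + y) = q x + q y" for x y
    using sublinear_add[OF q, of x y] sublinear_add[OF q, of "x + y" "- y"] odd[of y] by simp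
  moreover have "q (t *\<^sub>R x) = t * q x" for t x
  proof (cases "0 \<le> t")
    case False
    then have "q (- ((- t) *\<^sub>R x)) = - ((- t) * q x)"
      using sublinear_scale[OF q, of "- t" x] by (simp only: odd)
    then show ?thesis by simp
  qed (simp add: sublinear_scale[OF q])
  ultimately have "linear q" by (intro linearI) auto
  then show thesis using qp that by blast
qed

lemma strict_separation_closed_convex_point:
  fixes K :: "'a::real_normed_vector set"
  assumes "closed K" "convex K" "K \<noteq> {}" "x \<notin> K"
  obtains f :: "'a \<Rightarrow>\<^sub>L real" and d
    where "0 < d" "\<And>k. k \<in> K \<Longrightarrow> blinfun_apply f x + d \<le> blinfun_apply f k"
proof -
  obtain d where d: "0 < d" "\<And>k. k \<in> K \<Longrightarrow> d \<le> dist x k"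
  proof -
    obtain d where "0 < d" "ball x d \<subseteq> - K"
      using openE[of "- K" x] \<open>closed K\<close> \<open>x \<notin> K\<close> by (auto simp: open_Compl)
    then show ?thesis using that[of d] by (auto simp: subset_iff not_le[symmetric])
  qed
  define D where "D = (\<lambda>k. k - x) ` K"
  have "convex D" "D \<noteq> {}" using assms by (auto simp: D_def convex_translation_subtract)
  moreover have "d \<le> norm u" if "u \<in> D" for u
    using that d(2) by (auto simp: D_def dist_norm norm_minus_commute)
  ultimately obtain p where p: "sublinear p" "\<And>x. p x \<le> norm x" "\<And>u. u \<in> D \<Longrightarrow> p (- u) \<le> - d"
    using sublinear_decrease_on_convex[OF sublinear_norm] by metis
  obtain f where f: "linear f" "\<And>x. f x \<le> p x" using linear_below_sublinear[OF p(1)] by blast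
  have "norm (f y) \<le> norm y * 1" for y
  proof -
    have "f y \<le> norm y" "f (- y) \<le> norm (- y)" using f(2) p(2) order_trans by blast+
    then show ?thesis by (simp add: linear_neg[OF f(1)])
  qed
  then have bl: "bounded_linear f"
    using f(1) by (intro bounded_linear_intro[where K = 1]) (auto simp: linear_add linear_scale)
  have "f x + d \<le> f k" if "k \<in> K" for k
  proof -
    have "f (- (k - x)) \<le> - d"
      using f(2)[of "- (k - x)"] p(3)[of "k - x"] that by (auto simp: D_def)
    then show ?thesis by (simp add: linear_diff[OF f(1)])
  qed
  then show thesis
    by (intro that[of d "Blinfun f"] d(1)) (simp only: bounded_linear_Blinfun_apply[OF bl])
qed

text \<open>Mazur's theorem: by separation, the complement is a union of open half-spaces.\<close>
lemma closedin_weak_topology_closed_convex: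
  fixes K :: "'a::real_normed_vector set"
  assumes "closed K" "convex K"
  shows "closedin weak_topology K"
proof (cases "K = {}")
  case False
  have "openin weak_topology (- K)"
  proof (subst openin_subopen, intro ballI)
    fix x assume "x \<in> - K"
    then have "x \<notin> K" by simp
    then obtain f :: "'a \<Rightarrow>\<^sub>L real" and d where
      d: "0 < d" "\<And>k. k \<in> K \<Longrightarrow> blinfun_apply f x + d \<le> blinfun_apply f k"
      using strict_separation_closed_convex_point[OF assms False] by metis
    let ?U = "blinfun_apply f -` {..< blinfun_apply f x + d}"
    have "openin weak_topology ?U"
      unfolding weak_topology_def
      by (rule topology_generated_by_Basis) (use open_lessThan in blast)
    moreover have "x \<in> ?U" "?U \<subseteq> - K" using d by force+
    ultimately show "\<exists>U. openin weak_topology U \<and> x \<in> U \<and> U \<subseteq> - K" by blast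
  qed
  then show ?thesis by (simp add: closedin_def flip: Compl_eq_Diff_UNIV)
qed simp

section \<open>Asymptotic centers in weakly compact convex sets\<close>

definition asymptotic_sublevel :: "(nat \<Rightarrow> 'a::real_normed_vector) \<Rightarrow> real \<Rightarrow> 'a set" where
  "asymptotic_sublevel x c = {z. limsup (\<lambda>n. ereal (norm (x n - z))) \<le> ereal c}"

lemma mem_asymptotic_sublevel_iff:
  "z \<in> asymptotic_sublevel x c \<longleftrightarrow> (\<forall>e>0. \<forall>\<^sub>F n in sequentially. norm (x n - z) < c + e)"
proof -
  have "z \<in> asymptotic_sublevel x c \<longleftrightarrow>
      (\<forall>b>ereal c. \<forall>\<^sub>F n in sequentially. ereal (norm (x n - z)) < b)"
    by (simp add: asymptotic_sublevel_def Limsup_le_iff)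
  also have "\<dots> \<longleftrightarrow> (\<forall>e>0. \<forall>\<^sub>F n in sequentially. norm (x n - z) < c + e)"
  proof (intro iffI allI impI)
    fix e :: real assume *: "\<forall>b>ereal c. \<forall>\<^sub>F n in sequentially. ereal (norm (x n - z)) < b" "0 < e"
    then show "\<forall>\<^sub>F n in sequentially. norm (x n - z) < c + e"
      using *(1)[rule_format, of "ereal (c + e)"] by simp
  next
    fix b assume *: "\<forall>e>0. \<forall>\<^sub>F n in sequentially. norm (x n - z) < c + e" "ereal c < b"
    show "\<forall>\<^sub>F n in sequentially. ereal (norm (x n - z)) < b"
    proof (cases b)
      case (real r)
      then show ?thesis using *(1)[rule_format, of "r - c"] *(2) by simp
    qed (use *(2) in auto)
  qed
  finally show ?thesis .
qed

lemma convex_asymptotic_sublevel: "convex (asymptotic_sublevel x c)"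
proof (rule convexI)
  fix y z and u v :: real
  assume y: "y \<in> asymptotic_sublevel x c" and z: "z \<in> asymptotic_sublevel x c"
    and uv: "0 \<le> u" "0 \<le> v" "u + v = 1"
  show "u *\<^sub>R y + v *\<^sub>R z \<in> asymptotic_sublevel x c"
    unfolding mem_asymptotic_sublevel_iff
  proof (intro allI impI)
    fix e :: real assume "0 < e"
    then have "\<forall>\<^sub>F n in sequentially. norm (x n - y) < c + e"
      "\<forall>\<^sub>F n in sequentially. norm (x n - z) < c + e"
      using y z by (auto simp: mem_asymptotic_sublevel_iff)
    then show "\<forall>\<^sub>F n in sequentially. norm (x n - (u *\<^sub>R y + v *\<^sub>R z)) < c + e"
    proof eventually_elim
      case (elim n)
      then have "y \<in> ball (x n) (c + e)" "z \<in> ball (x n) (c + e)" by (auto simp: dist_norm)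
      then have "u *\<^sub>R y + v *\<^sub>R z \<in> ball (x n) (c + e)"
        using uv convex_ball by (blast intro: convexD)
      then show ?case by (simp add: dist_norm)
    qed
  qed
qed

lemma closed_asymptotic_sublevel: "closed (asymptotic_sublevel x c)"
  unfolding closure_subset_eq[symmetric]
proof
  fix z assume z: "z \<in> closure (asymptotic_sublevel x c)"
  show "z \<in> asymptotic_sublevel x c"
    unfolding mem_asymptotic_sublevel_iff
  proof (intro allI impI)
    fix e :: real assume e: "0 < e"
    obtain y where y: "y \<in> asymptotic_sublevel x c" "dist y z < e / 2"
      using z e unfolding closure_approachable by (meson half_gt_zero)
    have "\<forall>\<^sub>F n in sequentially. norm (x n - y) < c + e / 2"
      using y(1) e by (simp add: mem_asymptotic_sublevel_iff)
    then show "\<forall>\<^sub>F n in sequentially. norm (x n - z) < c + e"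
    proof eventually_elim
      case (elim n)
      then show ?case using y(2) dist_triangle[of "x n" z y] by (simp add: dist_norm)
    qed
  qed
qed

text \<open>Only sublevels strictly above the radius are used: these all meet \<open>C\<close>, which is what the
  finite intersection property needs. If the radius is infinite, the family of sublevels
  is empty and the center is \<open>C\<close>, so unbounded sequences are not a separate case.\<close>
lemma asymptotic_center_eq_Inter_sublevels:
  "asymptotic_center C x =
     C \<inter> (\<Inter>c\<in>{c. asymptotic_radius C x < ereal c}. asymptotic_sublevel x c)"
proof -
  let ?g = "\<lambda>z. limsup (\<lambda>n. ereal (norm (x n - z)))"
  have "?g z = asymptotic_radius C x \<longleftrightarrow> (\<forall>c. asymptotic_radius C x < ereal c \<longrightarrow> ?g z \<le> ereal c)"
    if "z \<in> C" for z
  proof -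
    have "asymptotic_radius C x \<le> ?g z"
      unfolding asymptotic_radius_def using that by (rule INF_lower)
    then have "?g z = asymptotic_radius C x \<longleftrightarrow> ?g z \<le> asymptotic_radius C x" by auto
    also have "\<dots> \<longleftrightarrow> (\<forall>c. asymptotic_radius C x < ereal c \<longrightarrow> ?g z \<le> ereal c)"
    proof (intro iffI allI impI)
      assume *: "\<forall>c. asymptotic_radius C x < ereal c \<longrightarrow> ?g z \<le> ereal c"
      show "?g z \<le> asymptotic_radius C x"
      proof (rule ccontr)
        assume "\<not> ?g z \<le> asymptotic_radius C x"
        then obtain c where "asymptotic_radius C x < ereal c" "ereal c < ?g z"
          using ereal_dense2[of "asymptotic_radius C x" "?g z"] by (auto simp: not_le)
        then show False using * by (auto simp: not_le[symmetric])
      qed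
    qed (meson less_imp_le order_trans)
    finally show ?thesis .
  qed
  then show ?thesis by (auto simp: asymptotic_center_def asymptotic_sublevel_def)
qed

lemma convex_asymptotic_center: "convex C \<Longrightarrow> convex (asymptotic_center C x)"
  unfolding asymptotic_center_eq_Inter_sublevels
  by (intro convex_Int convex_INT convex_asymptotic_sublevel)

text \<open>The sublevels in the preceding description are weakly closed, and they are nested, so finitely
  many of them meet \<open>C\<close> where the smallest one does.\<close>
lemma asymptotic_center_nonempty:
  assumes "C \<noteq> {}" "compactin weak_topology C"
  shows "asymptotic_center C x \<noteq> {}"
proof -
  let ?I = "{c. asymptotic_radius C x < ereal c}"
  have "C \<inter> \<Inter>\<F> \<noteq> {}" if fin: "finite \<F>" and sub: "\<F> \<subseteq> asymptotic_sublevel x ` ?I" for \<F>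
  proof -
    obtain J where J: "J \<subseteq> ?I" "finite J" "\<F> = asymptotic_sublevel x ` J"
      using finite_subset_image[OF fin sub] by auto
    show ?thesis
    proof (cases "J = {}")
      case False
      have "Min J \<in> ?I" using J False Min_in by blast
      then have "(INF z\<in>C. limsup (\<lambda>n. ereal (norm (x n - z)))) < ereal (Min J)"
        by (simp add: asymptotic_radius_def)
      then obtain z where z: "z \<in> C" "limsup (\<lambda>n. ereal (norm (x n - z))) < ereal (Min J)"
        unfolding INF_less_iff by blast
      have "z \<in> asymptotic_sublevel x c" if "c \<in> J" for c
      proof -
        have "ereal (Min J) \<le> ereal c" using J(2) that by simp
        then show ?thesis using order.trans[OF less_imp_le[OF z(2)]]
          by (simp add: asymptotic_sublevel_def)
      qed
      then show ?thesis using z(1) J(3) by blast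
    qed (use J \<open>C \<noteq> {}\<close> in simp)
  qed
  moreover have "closedin weak_topology K" if "K \<in> asymptotic_sublevel x ` ?I" for K
    using that closedin_weak_topology_closed_convex closed_asymptotic_sublevel
      convex_asymptotic_sublevel by blast
  ultimately have "C \<inter> \<Inter>(asymptotic_sublevel x ` ?I) \<noteq> {}"
    using assms(2) unfolding compactin_fip by blast
  then show ?thesis by (simp add: asymptotic_center_eq_Inter_sublevels)
qed

section \<open>Orbits of pointwise eventually nonexpansive mappings\<close>

lemma funpow_mem:
  assumes "pointwise_eventually_nonexpansive_on C T" "x \<in> C"
  shows "(T ^^ n) x \<in> C"
  using assms by (induction n) (auto simp: pointwise_eventually_nonexpansive_on_def)

text \<open>Once \<open>n\<close> exceeds the threshold of \<open>z\<close>, passing from \<open>z\<close> to \<open>T\<^sup>n z\<close> increases no distance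
  to the orbit, up to a shift by \<open>n\<close>, which the limit superior ignores. The threshold does not
  depend on \<open>c\<close>; therefore the statement carries over to the asymptotic center, which involves
  infinitely many levels at once.\<close>
lemma eventually_sublevel_invariant:
  assumes T: "pointwise_eventually_nonexpansive_on C T" and "x \<in> C" "z \<in> C"
  shows "\<forall>\<^sub>F n in sequentially. \<forall>c. z \<in> asymptotic_sublevel (\<lambda>m. (T ^^ m) x) c
           \<longrightarrow> (T ^^ n) z \<in> asymptotic_sublevel (\<lambda>m. (T ^^ m) x) c"
proof -
  obtain N where N: "\<And>n y. n \<ge> N \<Longrightarrow> y \<in> C \<Longrightarrow> norm ((T ^^ n) z - (T ^^ n) y) \<le> norm (z - y)"
    using T \<open>z \<in> C\<close> unfolding pointwise_eventually_nonexpansive_on_def by blast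
  have "(T ^^ n) z \<in> asymptotic_sublevel (\<lambda>m. (T ^^ m) x) c"
    if "n \<ge> N" "z \<in> asymptotic_sublevel (\<lambda>m. (T ^^ m) x) c" for n c
    unfolding mem_asymptotic_sublevel_iff
  proof (intro allI impI)
    fix e :: real assume "0 < e"
    then have "\<forall>\<^sub>F m in sequentially. norm ((T ^^ m) x - z) < c + e"
      using that(2) by (simp add: mem_asymptotic_sublevel_iff)
    then have "\<forall>\<^sub>F m in sequentially. norm ((T ^^ (m + n)) x - (T ^^ n) z) < c + e"
    proof eventually_elim
      case (elim m)
      have "norm ((T ^^ n) z - (T ^^ n) ((T ^^ m) x)) \<le> norm (z - (T ^^ m) x)"
        using N that(1) funpow_mem[OF T \<open>x \<in> C\<close>] by blast
      then show ?case using elim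
        by (simp add: norm_minus_commute add.commute[of m n] funpow_add)
    qed
    then show "\<forall>\<^sub>F m in sequentially. norm ((T ^^ m) x - (T ^^ n) z) < c + e"
      by (rule eventually_sequentially_seg[THEN iffD1])
  qed
  then show ?thesis unfolding eventually_sequentially by blast
qed

lemma eventually_asymptotic_center_invariant:
  assumes T: "pointwise_eventually_nonexpansive_on C T" and "x \<in> C"
    and z: "z \<in> asymptotic_center C (\<lambda>m. (T ^^ m) x)"
  shows "\<forall>\<^sub>F n in sequentially. (T ^^ n) z \<in> asymptotic_center C (\<lambda>m. (T ^^ m) x)"
proof -
  have "z \<in> C" using z by (simp add: asymptotic_center_def)
  from eventually_sublevel_invariant[OF T \<open>x \<in> C\<close> this] show ?thesis
    by eventually_elim
      (use z funpow_mem[OF T \<open>z \<in> C\<close>] in \<open>auto simp: asymptotic_center_eq_Inter_sublevels\<close>)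
qed

definition cluster_points :: "(nat \<Rightarrow> 'a::metric_space) \<Rightarrow> 'a set" where
  "cluster_points x = {w. \<forall>e>0. \<exists>\<^sub>F n in sequentially. dist (x n) w < e}"

lemma cluster_point_in_compact:
  assumes "compact B" and fr: "\<exists>\<^sub>F n in sequentially. x n \<in> B"
  shows "\<exists>w\<in>B. w \<in> cluster_points x"
proof (rule ccontr)
  assume "\<not> ?thesis"
  then have "\<forall>w\<in>B. \<exists>e>0. \<forall>\<^sub>F n in sequentially. \<not> dist (x n) w < e"
    by (auto simp: cluster_points_def frequently_def)
  then obtain e where e: "\<And>w. w \<in> B \<Longrightarrow> e w > 0"
    "\<And>w. w \<in> B \<Longrightarrow> \<forall>\<^sub>F n in sequentially. \<not> dist (x n) w < e w" by metis
  have "B \<subseteq> (\<Union>w\<in>B. ball w (e w))" using e(1) by force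
  then obtain F where F: "F \<subseteq> B" "finite F" "B \<subseteq> (\<Union>w\<in>F. ball w (e w))"
    using compactE_image[OF \<open>compact B\<close>, of B "\<lambda>w. ball w (e w)"] by auto
  have "\<forall>\<^sub>F n in sequentially. \<forall>w\<in>F. \<not> dist (x n) w < e w"
    using F e(2) by (intro eventually_ball_finite) auto
  then have "\<forall>\<^sub>F n in sequentially. x n \<notin> B"
    by eventually_elim (use F(3) in \<open>fastforce simp: dist_commute\<close>)
  then show False using fr by (simp add: frequently_def)
qed

lemma closed_cluster_points: "closed (cluster_points x)"
  unfolding closure_subset_eq[symmetric]
proof
  fix w assume w: "w \<in> closure (cluster_points x)"
  show "w \<in> cluster_points x"
    unfolding cluster_points_def
  proof (intro CollectI allI impI)
    fix e :: real assume e: "0 < e"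
    obtain v where v: "v \<in> cluster_points x" "dist v w < e / 2"
      using w e unfolding closure_approachable by (meson half_gt_zero)
    have "\<exists>\<^sub>F n in sequentially. dist (x n) v < e / 2"
      using v(1) half_gt_zero[OF e] unfolding cluster_points_def by blast
    then show "\<exists>\<^sub>F n in sequentially. dist (x n) w < e"
    proof (rule frequently_elim1)
      fix n assume "dist (x n) v < e / 2"
      then show "dist (x n) w < e" using v(2) dist_triangle[of "x n" w v] by simp
    qed
  qed
qed

lemma cluster_points_subset_closed:
  assumes "closed A" "\<forall>\<^sub>F n in sequentially. x n \<in> A"
  shows "cluster_points x \<subseteq> A"
proof
  fix w assume w: "w \<in> cluster_points x"
  have "\<exists>y\<in>A. dist y w < e" if "0 < e" for e
  proof -
    have "\<exists>\<^sub>F n in sequentially. dist (x n) w < e" using w that by (simp add: cluster_points_def)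
    note frequently_ex[OF frequently_eventually_frequently[OF this assms(2)]]
    then obtain n where "dist (x n) w < e" "x n \<in> A" by blast
    then show ?thesis by blast
  qed
  then show "w \<in> A" using closed_approachable[OF assms(1)] by blast
qed

text \<open>In a compact set the limit superior of the distances to \<open>z\<close> is attained at a cluster point.
  This links the sublevels, which iterates preserve, with the cluster points, to which the
  geometry of compact sets applies.\<close>
lemma sublevel_iff_cluster_points_le:
  fixes x :: "nat \<Rightarrow> 'a::real_normed_vector"
  assumes "compact A" "\<forall>\<^sub>F n in sequentially. x n \<in> A"
  shows "z \<in> asymptotic_sublevel x s \<longleftrightarrow> (\<forall>w\<in>cluster_points x. dist w z \<le> s)"
proof
  assume z: "z \<in> asymptotic_sublevel x s"
  show "\<forall>w\<in>cluster_points x. dist w z \<le> s"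
  proof (rule ballI, rule field_le_epsilon)
    fix w and e :: real assume w: "w \<in> cluster_points x" and e: "0 < e"
    have near: "\<exists>\<^sub>F n in sequentially. dist (x n) w < e / 2"
      using w half_gt_zero[OF e] unfolding cluster_points_def by blast
    have "\<forall>\<^sub>F n in sequentially. dist (x n) z < s + e / 2"
      using z half_gt_zero[OF e] unfolding mem_asymptotic_sublevel_iff dist_norm by blast
    from frequently_ex[OF frequently_eventually_frequently[OF near this]]
    obtain n where "dist (x n) w < e / 2" "dist (x n) z < s + e / 2" by blast
    then show "dist w z \<le> s + e" using dist_triangle3[of w z "x n"] by simp
  qed
next
  assume le: "\<forall>w\<in>cluster_points x. dist w z \<le> s"
  show "z \<in> asymptotic_sublevel x s"
    unfolding mem_asymptotic_sublevel_iff
  proof (intro allI impI, rule ccontr)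
    fix e :: real assume e: "0 < e" and "\<not> (\<forall>\<^sub>F n in sequentially. norm (x n - z) < s + e)"
    then have "\<exists>\<^sub>F n in sequentially. s + e \<le> dist z (x n)"
      by (simp add: frequently_def not_le dist_norm norm_minus_commute)
    from frequently_eventually_frequently[OF this assms(2)]
    have "\<exists>\<^sub>F n in sequentially. x n \<in> A \<inter> - ball z (s + e)"
      by (rule frequently_elim1) auto
    moreover have "compact (A \<inter> - ball z (s + e))"
      using assms(1) by (intro compact_Int_closed) (auto simp: closed_Compl)
    ultimately obtain w where "w \<in> cluster_points x" "s + e \<le> dist z w"
      using cluster_point_in_compact by force
    then show False using le e dist_commute[of z w] by fastforce
  qed
qed

section \<open>The fixed point\<close>

text \<open>Compact convex sets have normal structure. Take the barycenter of a finite \<open>diameter W / 2\<close>-net: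
  every \<open>w\<close> is within half the diameter of one of the net points and within the diameter of the
  others, so averaging over the \<open>n\<close> points gains \<open>diameter W / (2 n)\<close> uniformly in \<open>w\<close>.\<close>
lemma compact_nondiametral_point:
  fixes W :: "'a::real_normed_vector set"
  assumes W: "compact W" and pos: "0 < diameter W"
  obtains z s where "z \<in> convex hull W" "s < diameter W" "\<And>w. w \<in> W \<Longrightarrow> dist w z \<le> s"
proof -
  let ?d = "diameter W"
  have "W \<subseteq> (\<Union>w\<in>W. ball w (?d / 2))" using pos by force
  then obtain F where F: "F \<subseteq> W" "finite F" "W \<subseteq> (\<Union>w\<in>F. ball w (?d / 2))"
    using compactE_image[OF W, of W "\<lambda>w. ball w (?d / 2)"] by auto
  have "W \<noteq> {}" using pos by auto
  then have ne: "F \<noteq> {}" using F by auto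
  define n where "n = real (card F)"
  have n: "0 < n" using ne F(2) by (simp add: n_def card_gt_0_iff)
  define z where "z = (\<Sum>v\<in>F. (1 / n) *\<^sub>R v)"
  have "z \<in> convex hull W"
    unfolding z_def
  proof (rule convex_sum)
    show "(\<Sum>v\<in>F. 1 / n) = 1" using n by (simp add: n_def)
  qed (use F n hull_subset[of W convex] in auto)
  moreover have "?d - ?d / (2 * n) < ?d" using pos n by simp
  moreover have "dist w z \<le> ?d - ?d / (2 * n)" if w: "w \<in> W" for w
  proof -
    obtain v where v: "v \<in> F" "dist w v < ?d / 2" using F(3) w by (auto simp: dist_commute)
    have "n *\<^sub>R (w - z) = (\<Sum>u\<in>F. w - u)"
      using n by (simp add: z_def sum_subtractf scaleR_diff_right scaleR_sum_right n_def
          sum_constant_scaleR)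
    then have "n * dist w z = norm (\<Sum>u\<in>F. w - u)"
      using n by (metis abs_of_pos dist_norm norm_scaleR)
    also have "\<dots> \<le> (\<Sum>u\<in>F. dist w u)" unfolding dist_norm by (rule norm_sum)
    also have "\<dots> = dist w v + (\<Sum>u\<in>F - {v}. dist w u)"
      using F(2) v(1) by (rule sum.remove)
    also have "\<dots> \<le> ?d / 2 + (\<Sum>u\<in>F - {v}. ?d)"
      using v(2) F(1) w compact_imp_bounded[OF W]
      by (intro add_mono sum_mono diameter_bounded_bound) auto
    also have "\<dots> = ?d / 2 + (n - 1) * ?d"
      using F(2) v(1) ne by (simp add: n_def card_Diff_singleton of_nat_diff Suc_leI card_gt_0_iff)
    also have "\<dots> = n * (?d - ?d / (2 * n))" using n by (simp add: field_simps)
    finally show ?thesis using n by simp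
  qed
  ultimately show thesis using that by blast
qed

text \<open>The minimal set argument. The sets in \<open>\<K>\<close> are closed under cluster points of orbits rather than
  under the iterates themselves, so that chains have lower bounds.\<close>
lemma fixed_point_in_compact_eventually_invariant:
  fixes A :: "'a::real_normed_vector set"
  assumes T: "pointwise_eventually_nonexpansive_on C T"
    and A: "A \<subseteq> C" "compact A" "convex A" "A \<noteq> {}"
    and inv: "\<And>x. x \<in> A \<Longrightarrow> \<forall>\<^sub>F n in sequentially. (T ^^ n) x \<in> A"
  shows "\<exists>x\<in>C. T x = x"
proof -
  define \<omega> where "\<omega> x = cluster_points (\<lambda>n. (T ^^ n) x)" for x
  have \<omega>A: "\<omega> x \<subseteq> A" if "x \<in> A" for x
    unfolding \<omega>_def
    by (rule cluster_points_subset_closed[OF compact_imp_closed[OF A(2)] inv[OF that]])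
  have \<omega>_ne: "\<omega> x \<noteq> {}" if "x \<in> A" for x
  proof -
    have "\<exists>\<^sub>F n in sequentially. (T ^^ n) x \<in> A"
      using inv[OF that] by (intro eventually_frequently) auto
    from cluster_point_in_compact[OF A(2) this] show ?thesis by (auto simp: \<omega>_def)
  qed
  define \<K> where "\<K> = {K. K \<subseteq> A \<and> K \<noteq> {} \<and> closed K \<and> convex K \<and> (\<forall>x\<in>K. \<omega> x \<subseteq> K)}"
  let ?R = "relation_of (\<lambda>K L. L \<subseteq> (K :: 'a set)) \<K>"
  have "\<exists>K\<in>\<K>. \<forall>L\<in>\<K>. L \<subseteq> K \<longrightarrow> L = K"
  proof (rule predicate_Zorn)
    show "partial_order_on \<K> ?R"
      by (auto simp: partial_order_on_def preorder_on_def refl_on_def trans_def antisym_def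
          relation_of_def)
  next
    fix S assume "S \<in> Chains ?R"
    then have SK: "S \<subseteq> \<K>" and chain: "\<And>K L. K \<in> S \<Longrightarrow> L \<in> S \<Longrightarrow> K \<subseteq> L \<or> L \<subseteq> K"
      by (auto simp: Chains_def relation_of_def)
    have AK: "A \<in> \<K>" using A \<omega>A by (simp add: \<K>_def compact_imp_closed)
    have "A \<inter> \<Inter>S \<noteq> {}"
    proof (rule compact_imp_fip[OF A(2)])
      show "closed K" if "K \<in> S" for K using that SK by (auto simp: \<K>_def)
    next
      fix F assume F: "finite F" "F \<subseteq> S"
      show "A \<inter> \<Inter>F \<noteq> {}"
      proof (cases "F = {}")
        case False
        have "K \<inter> L \<in> F" if "K \<in> F" "L \<in> F" for K L
          using chain[of K L] that F(2) by (metis Int_absorb1 Int_absorb2 subsetD)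
        then have "\<Inter>F \<in> F" by (rule finite_Inf_in[OF F(1) False])
        then have "\<Inter>F \<in> \<K>" using F(2) SK by blast
        then have "\<Inter>F \<subseteq> A" "\<Inter>F \<noteq> {}" unfolding \<K>_def by blast+
        then show ?thesis by (simp only: Int_absorb1 simp_thms)
      qed (use A in simp)
    qed
    moreover have "closed (A \<inter> \<Inter>S)"
      using SK compact_imp_closed[OF A(2)] by (intro closed_Int closed_Inter) (auto simp: \<K>_def)
    moreover have "convex (A \<inter> \<Inter>S)"
      using SK A(3) by (intro convex_Int convex_Inter) (auto simp: \<K>_def)
    moreover have "\<omega> x \<subseteq> A \<inter> \<Inter>S" if x: "x \<in> A \<inter> \<Inter>S" for x
    proof -
      have "\<omega> x \<subseteq> K" if "K \<in> S" for K using that x SK unfolding \<K>_def by blast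
      then show ?thesis using \<omega>A x by blast
    qed
    ultimately have "A \<inter> \<Inter>S \<in> \<K>" by (simp add: \<K>_def)
    then show "\<exists>u\<in>\<K>. \<forall>K\<in>S. u \<subseteq> K"
      by (rule bexI[rotated]) auto
  qed
  then obtain K where K: "K \<in> \<K>" and min: "\<And>L. L \<in> \<K> \<Longrightarrow> L \<subseteq> K \<Longrightarrow> L = K" by metis
  have KA: "K \<subseteq> A" and cK: "closed K" "convex K" and K\<omega>: "\<And>x. x \<in> K \<Longrightarrow> \<omega> x \<subseteq> K"
    using K by (auto simp: \<K>_def)
  obtain x where x: "x \<in> K" using K by (auto simp: \<K>_def)
  have xA: "x \<in> A" and xC: "x \<in> C" using x KA A by auto
  have subl: "z \<in> asymptotic_sublevel (\<lambda>n. (T ^^ n) y) s \<longleftrightarrow> (\<forall>w\<in>\<omega> y. dist w z \<le> s)"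
    if "y \<in> A" for y z s
    unfolding \<omega>_def by (rule sublevel_iff_cluster_points_le[OF A(2) inv[OF that]])
  \<comment> \<open>By minimality, a bound on the distances from one point of \<open>K\<close> to \<open>\<omega> x\<close> holds for all points.\<close>
  have all: "dist w z \<le> s"
    if zs: "z0 \<in> K" "\<forall>w\<in>\<omega> x. dist w z0 \<le> s" and "z \<in> K" "w \<in> \<omega> x" for z0 s z w
  proof -
    let ?L = "asymptotic_sublevel (\<lambda>n. (T ^^ n) x) s"
    have "K \<inter> ?L \<in> \<K>"
      unfolding \<K>_def
    proof (intro CollectI conjI ballI)
      show "K \<inter> ?L \<subseteq> A" using KA by auto
      show "K \<inter> ?L \<noteq> {}" using zs subl[OF xA] by auto
      show "closed (K \<inter> ?L)" "convex (K \<inter> ?L)"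
        using cK by (auto intro: closed_Int convex_Int closed_asymptotic_sublevel
            convex_asymptotic_sublevel)
      fix y assume y: "y \<in> K \<inter> ?L"
      have "y \<in> C" using y KA A(1) by blast
      from eventually_sublevel_invariant[OF T xC this]
      have "\<forall>\<^sub>F n in sequentially. (T ^^ n) y \<in> ?L"
        by (rule eventually_mono) (use y in blast)
      then have "\<omega> y \<subseteq> ?L"
        unfolding \<omega>_def by (rule cluster_points_subset_closed[OF closed_asymptotic_sublevel])
      then show "\<omega> y \<subseteq> K \<inter> ?L" using y K\<omega> by auto
    qed
    then have "K \<inter> ?L = K" by (intro min) auto
    then show ?thesis using that subl[OF xA] by blast
  qed
  have W: "compact (\<omega> x)"
  proof -
    have "compact (A \<inter> \<omega> x)"
      unfolding \<omega>_def by (intro compact_Int_closed A closed_cluster_points)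
    then show ?thesis using \<omega>A[OF xA] by (simp add: Int_absorb1)
  qed
  have "diameter (\<omega> x) \<le> 0"
  proof (rule ccontr)
    assume "\<not> ?thesis"
    then obtain z s where z: "z \<in> convex hull (\<omega> x)" "s < diameter (\<omega> x)"
      and s: "\<And>w. w \<in> \<omega> x \<Longrightarrow> dist w z \<le> s"
      using compact_nondiametral_point[OF W] by (metis not_le)
    have "z \<in> K" using z(1) hull_minimal[of "\<omega> x" K convex] K\<omega>[OF x] cK by auto
    then have "dist w v \<le> s" if "w \<in> \<omega> x" "v \<in> \<omega> x" for w v
      using all s that K\<omega>[OF x] by blast
    then have "diameter (\<omega> x) \<le> s"
      using \<omega>_ne[OF xA] by (intro diameter_le) (auto simp: dist_norm)
    then show False using z(2) by simp
  qed
  then have "dist w v \<le> 0" if "w \<in> \<omega> x" "v \<in> \<omega> x" for w v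
    using diameter_bounded_bound[OF compact_imp_bounded[OF W] that] by linarith
  moreover obtain z where z: "z \<in> \<omega> x" using \<omega>_ne[OF xA] by auto
  ultimately have "dist z v \<le> 0" if "v \<in> K" for v
    using all[of z 0 v z] z that K\<omega>[OF x] by blast
  then have zK: "v = z" if "v \<in> K" for v using that by force
  have zA: "z \<in> A" and zC: "z \<in> C" and \<omega>z: "\<omega> z \<subseteq> {z}"
    using z \<omega>A[OF xA] A(1) K\<omega> x zK by blast+
  have lim: "(\<lambda>n. (T ^^ n) z) \<longlonglongrightarrow> z"
  proof -
    have "z \<in> asymptotic_sublevel (\<lambda>n. (T ^^ n) z) 0" using subl[OF zA, of z 0] \<omega>z by auto
    then show ?thesis by (simp add: mem_asymptotic_sublevel_iff tendsto_iff dist_norm)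
  qed
  obtain N where N: "\<And>n y. n \<ge> N \<Longrightarrow> y \<in> C \<Longrightarrow> norm ((T ^^ n) z - (T ^^ n) y) \<le> norm (z - y)"
    using T zC unfolding pointwise_eventually_nonexpansive_on_def by blast
  \<comment> \<open>Nonexpansiveness at \<open>z\<close> makes the shifted orbit converge to \<open>T\<^sup>n z\<close> as well as to \<open>z\<close>.\<close>
  have per: "(T ^^ n) z = z" if "n \<ge> N" for n
  proof -
    have "(\<lambda>m. (T ^^ (m + n)) z) \<longlonglongrightarrow> (T ^^ n) z"
    proof (rule Lim_null[THEN iffD2], rule Lim_transform_bound[where g = "\<lambda>m. (T ^^ m) z - z"])
      show "\<forall>\<^sub>F m in sequentially. norm ((T ^^ (m + n)) z - (T ^^ n) z) \<le> norm ((T ^^ m) z - z)"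
        using N[OF that funpow_mem[OF T zC]]
        by (simp add: norm_minus_commute add.commute[of _ n] funpow_add)
      show "(\<lambda>m. (T ^^ m) z - z) \<longlonglongrightarrow> 0" using lim by (simp add: Lim_null[symmetric])
    qed
    then show ?thesis using LIMSEQ_ignore_initial_segment[OF lim, of n] LIMSEQ_unique by blast
  qed
  have "T z = T ((T ^^ N) z)" using per[of N] by simp
  also have "\<dots> = z" using per[of "Suc N"] by simp
  finally show ?thesis using zC by blast
qed

theorem theorem5p6:
  fixes C :: "'a::banach set" and T :: "'a \<Rightarrow> 'a"
  assumes "C \<noteq> {}"
    and "compactin weak_topology C"
    and "convex C"
    and "pointwise_eventually_nonexpansive_on C T"
    and "\<And>x :: nat \<Rightarrow> 'a. (\<And>n. x n \<in> C) \<Longrightarrow> compact (asymptotic_center C x)"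
  shows "\<exists>x\<in>C. T x = x"
proof -
  obtain x where x: "x \<in> C" using assms(1) by auto
  let ?A = "asymptotic_center C (\<lambda>n. (T ^^ n) x)"
  show ?thesis
  proof (rule fixed_point_in_compact_eventually_invariant[OF assms(4)])
    show "?A \<subseteq> C" by (auto simp: asymptotic_center_def)
    show "compact ?A" using funpow_mem[OF assms(4) x] by (intro assms(5))
    show "convex ?A" using assms(3) by (rule convex_asymptotic_center)
    show "?A \<noteq> {}" using assms(1,2) by (rule asymptotic_center_nonempty)
  qed (rule eventually_asymptotic_center_invariant[OF assms(4) x])
qed

end
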